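(* Let $\mathcal{T}$ be a $\Sigma_1$-theory. If $\mathcal{T}$ is gentle, then its natural density $\mu(\mathcal{T})$ is well-defined and equal to $0$ or $1$.
   Context: $\Sigma_1$ is the one-sorted first-order signature with no function or predicate symbols other than equality. Interpretations have non-empty domains and assign values to all variables; a theory is the class of all interpretations satisfying a given set of sentences (not necessarily computably enumerable). For a quantifier-free formula $\phi$, $\mathrm{Spec}(\mathcal{T},\phi)$ is the set of finite cardinalities of domains of $\mathcal{T}$-interpretations satisfying $\phi$; $\mathrm{Spec}(\mathcal{T})$ is the set of finite cardinalities of domains of $\mathcal{T}$-interpretations; $\mathrm{Spec}_n(\mathcal{T})=\mathrm{Spec}(\mathcal{T})\cap\{1,\dots,n\}$; $\mu(\mathcal{T})=\lim_{n\to\infty}|\mathrm{Spec}_n(\mathcal{T})|/n$ (well-defined if the limit exists). $\mathcal{T}$ is gentle if for every quantifier-free formula $\phi$: (i) $\mathrm{Spec}(\mathcal{T},\phi)$ is computable; (ii) $\mathrm{Spec}(\mathcal{T},\phi)$ is either co-finite in $\mathbb{N}$ or finite, and there is an algorithm taking $\phi$ as input that decides which is the case; (iii) if $\mathrm{Spec}(\mathcal{T},\phi)$ is finite then its maximum is computable from $\phi$, and if it is infinite then $\max(\mathbb{N}\setminus\mathrm{Spec}(\mathcal{T},\phi))$ is computable from $\phi$ (the maximum of the empty set being $0$). *)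

theory Defs
  imports Complex_Main "HOL-Library.Nat_Bijection" "HOL-Library.Infinite_Typeclass"
begin

subsection \<open>First-order logic over the empty one-sorted signature\<close>

datatype form =
    Eq nat nat
  | Neg form
  | Conj form form
  | Disj form form
  | Impl form form
  | All nat form
  | Ex nat form

fun quantifier_free :: "form \<Rightarrow> bool" where
  "quantifier_free (Eq x y) = True"
| "quantifier_free (Neg \<phi>) = quantifier_free \<phi>"
| "quantifier_free (Conj \<phi> \<psi>) = (quantifier_free \<phi> \<and> quantifier_free \<psi>)"
| "quantifier_free (Disj \<phi> \<psi>) = (quantifier_free \<phi> \<and> quantifier_free \<psi>)"
| "quantifier_free (Impl \<phi> \<psi>) = (quantifier_free \<phi> \<and> quantifier_free \<psi>)"
| "quantifier_free (All x \<phi>) = False"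
| "quantifier_free (Ex x \<phi>) = False"

fun free_vars :: "form \<Rightarrow> nat set" where
  "free_vars (Eq x y) = {x, y}"
| "free_vars (Neg \<phi>) = free_vars \<phi>"
| "free_vars (Conj \<phi> \<psi>) = free_vars \<phi> \<union> free_vars \<psi>"
| "free_vars (Disj \<phi> \<psi>) = free_vars \<phi> \<union> free_vars \<psi>"
| "free_vars (Impl \<phi> \<psi>) = free_vars \<phi> \<union> free_vars \<psi>"
| "free_vars (All x \<phi>) = free_vars \<phi> - {x}"
| "free_vars (Ex x \<phi>) = free_vars \<phi> - {x}"

definition sentence :: "form \<Rightarrow> bool" where
  "sentence \<phi> \<longleftrightarrow> free_vars \<phi> = {}"

text \<open>
  The domain of an interpretation is a subset of an ambient type \<open>'u\<close>.  When \<open>'u\<close> is infinite,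
  every finite domain is isomorphic to one inside \<open>'u\<close>, so that the spectra below, which concern
  only finite domains, are those of the class of all interpretations.
\<close>

record 'u interp =
  dom :: "'u set"
  val :: "nat \<Rightarrow> 'u"

definition interpretation_of :: "'u interp \<Rightarrow> bool" where
  "interpretation_of A \<longleftrightarrow> dom A \<noteq> {} \<and> (\<forall>x. val A x \<in> dom A)"

fun satisfies :: "'u interp \<Rightarrow> form \<Rightarrow> bool" where
  "satisfies A (Eq x y) \<longleftrightarrow> val A x = val A y"
| "satisfies A (Neg \<phi>) \<longleftrightarrow> \<not> satisfies A \<phi>"
| "satisfies A (Conj \<phi> \<psi>) \<longleftrightarrow> satisfies A \<phi> \<and> satisfies A \<psi>"
| "satisfies A (Disj \<phi> \<psi>) \<longleftrightarrow> satisfies A \<phi> \<or> satisfies A \<psi>"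
| "satisfies A (Impl \<phi> \<psi>) \<longleftrightarrow> (satisfies A \<phi> \<longrightarrow> satisfies A \<psi>)"
| "satisfies A (All x \<phi>) \<longleftrightarrow> (\<forall>d \<in> dom A. satisfies (A\<lparr>val := (val A)(x := d)\<rparr>) \<phi>)"
| "satisfies A (Ex x \<phi>) \<longleftrightarrow> (\<exists>d \<in> dom A. satisfies (A\<lparr>val := (val A)(x := d)\<rparr>) \<phi>)"

definition is_theory :: "'u interp set \<Rightarrow> bool" where
  "is_theory T \<longleftrightarrow>
     (\<exists>\<Gamma>. (\<forall>\<gamma> \<in> \<Gamma>. sentence \<gamma>) \<and>
          T = {A. interpretation_of A \<and> (\<forall>\<gamma> \<in> \<Gamma>. satisfies A \<gamma>)})"

subsection \<open>Spectra and natural density\<close>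

definition Spec_form :: "'u interp set \<Rightarrow> form \<Rightarrow> nat set" where
  "Spec_form T \<phi> = {card (dom A) | A. A \<in> T \<and> finite (dom A) \<and> satisfies A \<phi>}"

definition Spec :: "'u interp set \<Rightarrow> nat set" where
  "Spec T = {card (dom A) | A. A \<in> T \<and> finite (dom A)}"

definition Spec_upto :: "'u interp set \<Rightarrow> nat \<Rightarrow> nat set" where
  "Spec_upto T n = Spec T \<inter> {1..n}"

definition density_seq :: "'u interp set \<Rightarrow> nat \<Rightarrow> real" where
  "density_seq T n = real (card (Spec_upto T n)) / real n"

definition density_well_defined :: "'u interp set \<Rightarrow> bool" where
  "density_well_defined T \<longleftrightarrow> convergent (density_seq T)"

text \<open>Only meaningful under \<^const>\<open>density_well_defined\<close>.\<close>

definition natural_density :: "'u interp set \<Rightarrow> real" where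
  "natural_density T = lim (density_seq T)"

subsection \<open>Computability\<close>

text \<open>
  Partial recursive functions.  \<open>rec_eval r xs y\<close> means that \<open>r\<close> halts on \<open>xs\<close> with value \<open>y\<close>.
  In \<open>Prec f g\<close> and \<open>Mu f\<close> the recursion resp. search variable is the first argument.
\<close>

datatype recf =
    Zero
  | Succ
  | Proj nat
  | Comp recf "recf list"
  | Prec recf recf
  | Mu recf

inductive rec_eval :: "recf \<Rightarrow> nat list \<Rightarrow> nat \<Rightarrow> bool" where
  Zero: "rec_eval Zero xs 0"
| Succ: "rec_eval Succ [x] (Suc x)"
| Proj: "i < length xs \<Longrightarrow> rec_eval (Proj i) xs (xs ! i)"
| Comp: "list_all2 (\<lambda>g y. rec_eval g xs y) gs ys \<Longrightarrow> rec_eval f ys z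
          \<Longrightarrow> rec_eval (Comp f gs) xs z"
| Prec_0: "rec_eval f xs z \<Longrightarrow> rec_eval (Prec f g) (0 # xs) z"
| Prec_Suc: "rec_eval (Prec f g) (n # xs) y \<Longrightarrow> rec_eval g (n # y # xs) z
          \<Longrightarrow> rec_eval (Prec f g) (Suc n # xs) z"
| Mu: "rec_eval f (n # xs) 0 \<Longrightarrow> \<forall>i<n. \<exists>y. rec_eval f (i # xs) (Suc y)
          \<Longrightarrow> rec_eval (Mu f) xs n"

inductive_cases rec_eval_ZeroE: "rec_eval Zero xs z"
inductive_cases rec_eval_SuccE: "rec_eval Succ xs z"
inductive_cases rec_eval_ProjE: "rec_eval (Proj i) xs z"
inductive_cases rec_eval_Prec_0E: "rec_eval (Prec f g) (0 # xs) z"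
inductive_cases rec_eval_Prec_SucE: "rec_eval (Prec f g) (Suc n # xs) z"
inductive_cases rec_eval_CompE: "rec_eval (Comp f gs) xs z"
inductive_cases rec_eval_MuE: "rec_eval (Mu f) xs z"

lemma rec_eval_deterministic:
  "rec_eval r xs y \<Longrightarrow> rec_eval r xs z \<Longrightarrow> y = z"
proof (induction arbitrary: z rule: rec_eval.induct)
  case (Zero xs)
  then show ?case by (rule rec_eval_ZeroE) simp
next
  case (Succ x)
  then show ?case by (rule rec_eval_SuccE) simp
next
  case (Proj i xs)
  from Proj.prems show ?case by (rule rec_eval_ProjE) simp
next
  case (Comp xs gs ys f w)
  from Comp.prems obtain ys' where
    ys': "list_all2 (\<lambda>g y. rec_eval g xs y) gs ys'" and f: "rec_eval f ys' z"
    by (rule rec_eval_CompE)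
  have len: "length ys = length gs" "length ys' = length gs"
    using list_all2_lengthD[OF Comp.IH(1)] list_all2_lengthD[OF ys'] by simp_all
  have "ys = ys'"
  proof (rule nth_equalityI)
    show "length ys = length ys'" using len by simp
    fix i assume "i < length ys"
    then have i: "i < length gs" using len by simp
    show "ys ! i = ys' ! i"
      using list_all2_nthD[OF Comp.IH(1) i] list_all2_nthD[OF ys' i] by blast
  qed
  then have "rec_eval f ys z" using f by simp
  then show ?case by (rule Comp.IH(2))
next
  case (Prec_0 f xs w g)
  from Prec_0.prems have "rec_eval f xs z" by (rule rec_eval_Prec_0E)
  then show ?case by (rule Prec_0.IH)
next
  case (Prec_Suc f g n xs y w)
  from Prec_Suc.prems obtain y' where
    y': "rec_eval (Prec f g) (n # xs) y'" "rec_eval g (n # y' # xs) z"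
    by (rule rec_eval_Prec_SucE)
  from y'(1) have "y = y'" by (rule Prec_Suc.IH(1))
  with y'(2) have "rec_eval g (n # y # xs) z" by simp
  then show ?case by (rule Prec_Suc.IH(2))
next
  case (Mu f n xs)
  from Mu.prems obtain z: "rec_eval f (z # xs) 0" "\<forall>i<z. \<exists>y. rec_eval f (i # xs) (Suc y)"
    by (rule rec_eval_MuE)
  show ?case
  proof (rule linorder_cases[of n z])
    assume "n < z"
    with z(2) obtain y where "rec_eval f (n # xs) (Suc y)" by blast
    then have "0 = Suc y" by (rule Mu.IH(1))
    then show ?thesis by simp
  next
    assume "z < n"
    with Mu.IH(2) obtain y where "\<forall>w. rec_eval f (z # xs) w \<longrightarrow> Suc y = w" by blast
    with z(1) have "Suc y = 0" by simp
    then show ?thesis by simp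
  qed
qed

definition computable_set :: "nat set \<Rightarrow> bool" where
  "computable_set S \<longleftrightarrow> (\<exists>r. \<forall>n. rec_eval r [n] (if n \<in> S then 1 else 0))"

text \<open>Goedel numbering by the Cantor pairing function.\<close>

fun form_encode :: "form \<Rightarrow> nat" where
  "form_encode (Eq x y) = prod_encode (0, prod_encode (x, y))"
| "form_encode (Neg \<phi>) = prod_encode (1, form_encode \<phi>)"
| "form_encode (Conj \<phi> \<psi>) = prod_encode (2, prod_encode (form_encode \<phi>, form_encode \<psi>))"
| "form_encode (Disj \<phi> \<psi>) = prod_encode (3, prod_encode (form_encode \<phi>, form_encode \<psi>))"
| "form_encode (Impl \<phi> \<psi>) = prod_encode (4, prod_encode (form_encode \<phi>, form_encode \<psi>))"
| "form_encode (All x \<phi>) = prod_encode (5, prod_encode (x, form_encode \<phi>))"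
| "form_encode (Ex x \<phi>) = prod_encode (6, prod_encode (x, form_encode \<phi>))"

lemma form_encode_inject: "form_encode \<phi> = form_encode \<psi> \<longleftrightarrow> \<phi> = \<psi>"
proof (induction \<phi> arbitrary: \<psi>)
  case (Eq x y) show ?case by (cases \<psi>) auto
next
  case (Neg \<phi>) then show ?case by (cases \<psi>) auto
next
  case (Conj \<phi>1 \<phi>2) then show ?case by (cases \<psi>) auto
next
  case (Disj \<phi>1 \<phi>2) then show ?case by (cases \<psi>) auto
next
  case (Impl \<phi>1 \<phi>2) then show ?case by (cases \<psi>) auto
next
  case (All x \<phi>) then show ?case by (cases \<psi>) auto
next
  case (Ex x \<phi>) then show ?case by (cases \<psi>) auto
qed

text \<open>The algorithm may behave arbitrarily on inputs outside \<open>F\<close>.\<close>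

definition computable_from_form :: "form set \<Rightarrow> (form \<Rightarrow> nat) \<Rightarrow> bool" where
  "computable_from_form F f \<longleftrightarrow> (\<exists>r. \<forall>\<phi> \<in> F. rec_eval r [form_encode \<phi>] (f \<phi>))"

definition decidable_from_form :: "form set \<Rightarrow> (form \<Rightarrow> bool) \<Rightarrow> bool" where
  "decidable_from_form F P \<longleftrightarrow> computable_from_form F (\<lambda>\<phi>. if P \<phi> then 1 else 0)"

subsection \<open>Gentle theories\<close>

definition max0 :: "nat set \<Rightarrow> nat" where
  "max0 S = (if S = {} then 0 else Max S)"

text \<open>
  Spectra never contain 0, so it is immaterial for cofiniteness and for \<^const>\<open>max0\<close> of the
  complement whether 0 counts as a natural number.
\<close>

definition gentle :: "'u interp set \<Rightarrow> bool" where
  "gentle T \<longleftrightarrow>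
     (\<forall>\<phi>. quantifier_free \<phi> \<longrightarrow> computable_set (Spec_form T \<phi>)) \<and>
     (\<forall>\<phi>. quantifier_free \<phi> \<longrightarrow> finite (- Spec_form T \<phi>) \<or> finite (Spec_form T \<phi>)) \<and>
     decidable_from_form {\<phi>. quantifier_free \<phi>} (\<lambda>\<phi>. finite (Spec_form T \<phi>)) \<and>
     computable_from_form {\<phi>. quantifier_free \<phi> \<and> finite (Spec_form T \<phi>)}
       (\<lambda>\<phi>. max0 (Spec_form T \<phi>)) \<and>
     computable_from_form {\<phi>. quantifier_free \<phi> \<and> infinite (Spec_form T \<phi>)}
       (\<lambda>\<phi>. max0 (- Spec_form T \<phi>))"

end

theory Submission imports Defs begin

text \<open>A valid quantifier-free formula has the same spectrum as the theory itself, so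
  gentleness forces \<open>Spec T\<close> to be finite or cofinite. A finite set of naturals has
  density 0 (\<open>density_finite_tendsto_0\<close>), as its counting function is bounded; a
  cofinite one has density 1 (\<open>density_cofinite_tendsto_1\<close>).\<close>

lemma density_finite_tendsto_0:
  fixes S :: "nat set"
  assumes "finite S"
  shows "(\<lambda>n. real (card (S \<inter> {1..n})) / real n) \<longlonglongrightarrow> 0"
proof (rule tendsto_sandwich[OF _ _ tendsto_const])
  show "(\<lambda>n. real (card S) / real n) \<longlonglongrightarrow> 0"
    by (rule lim_const_over_n)
  show "\<forall>\<^sub>F n in sequentially. real (card (S \<inter> {1..n})) / real n \<le> real (card S) / real n"
    using assms by (intro always_eventually allI divide_right_mono) (auto intro: card_mono)
qed simp

text \<open>The finite complement has density 0, and the counts of \<open>S\<close> and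
  \<open>- S\<close> up to \<open>n\<close> add up to \<open>n\<close>.\<close>

lemma density_cofinite_tendsto_1:
  fixes S :: "nat set"
  assumes "finite (- S)"
  shows "(\<lambda>n. real (card (S \<inter> {1..n})) / real n) \<longlonglongrightarrow> 1"
proof (rule Lim_transform_eventually)
  show "(\<lambda>n. 1 - real (card (- S \<inter> {1..n})) / real n) \<longlonglongrightarrow> 1"
    using tendsto_diff[OF tendsto_const[of 1] density_finite_tendsto_0[OF assms]] by simp
  show "\<forall>\<^sub>F n in sequentially.
    1 - real (card (- S \<inter> {1..n})) / real n = real (card (S \<inter> {1..n})) / real n"
    \<comment> \<open>The identity fails at \<open>n = 0\<close>: division by zero yields 0, so it
      would read 1 = 0.\<close>
    using eventually_gt_at_top[of 0]
  proof eventually_elim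
    case (elim n)
    have "card {1..n} = card (S \<inter> {1..n}) + card (- S \<inter> {1..n})"
      using card_Int_Diff[of "{1..n}" S] by (simp add: Int_commute Diff_eq)
    then have "real n = real (card (S \<inter> {1..n})) + real (card (- S \<inter> {1..n}))"
      by simp
    with elim show ?case
      by (simp add: field_simps)
  qed
qed

text \<open>\<open>Eq x x\<close> holds in every interpretation; this carries statements about
  quantifier-free formulas over to \<open>Spec T\<close>.\<close>

lemma Spec_form_Eq_refl: "Spec_form T (Eq x x) = Spec T"
  by (simp add: Spec_form_def Spec_def)

theorem theorem2:
  fixes T :: "'u::infinite interp set"
  assumes "is_theory T"
    and "gentle T"
  shows "density_well_defined T \<and> (natural_density T = 0 \<or> natural_density T = 1)"
proof -
  \<comment> \<open>Any variable would serve in place of 0.\<close>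
  have "finite (- Spec_form T (Eq 0 0)) \<or> finite (Spec_form T (Eq 0 0))"
    using assms(2) quantifier_free.simps(1) unfolding gentle_def by blast
  then have "density_seq T \<longlonglongrightarrow> 1 \<or> density_seq T \<longlonglongrightarrow> 0"
    using density_cofinite_tendsto_1[of "Spec T"] density_finite_tendsto_0[of "Spec T"]
    unfolding Spec_form_Eq_refl density_seq_def Spec_upto_def by blast
  then show ?thesis
    unfolding density_well_defined_def natural_density_def by (auto intro: convergentI limI)
qed

end
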